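(* Let $N\ge1$ and $K\ge1$ be integers, let $\{V_k:k\in[K]\}$ consist of non-empty and pairwise disjoint subsets of $[N]$, and let $\{a_k:k\in[K]\}$ be given such that $a_k\in\mathbb{A}_{V_k}$ for each $k\in[K]$. Let $a=\sum_{k\in[K]}a_k$ and $\tilde a=\sum_{k\in[K]}\phi(\kappa(V_k))$. Then for any vector $c=(c^1,\dots,c^N)$ of strictly positive reals, $$N^{\rm eff}(\tilde a,c)\ \ge\ N^{\rm eff}(a,c)\ \ge\ \min_{k\in[K]}\left\{\frac{N^{\rm eff}(a_k,c)}{|V_k|}\right\}N^{\rm eff}(\tilde a,c).$$
   Context: $[M]:=\{1,\dots,M\}$. For non-empty $V\subseteq[N]$, $\mathbb{A}_V$ is the set of substochastic $N\times N$ matrices $a=(a^{ij})$ (nonnegative entries, each row sum at most $1$) such that (i) $a$ leaves the uniform distribution $\mu$ on $V$ invariant, i.e. $\mu a=\mu$ with $\mu$ viewed as a row vector on $[N]$, and (ii) $a^{ij}=0$ whenever $(i,j)\in[N]^2\setminus V^2$. For non-empty $V\subseteq[N]$, $\kappa(V)$ is the complete graph (with self-loops) on $V$, and $\phi(\kappa(V))$ is the $N\times N$ matrix with $(i,j)$ entry $|V|^{-1}$ if $i,j\in V$ and $0$ otherwise. For a matrix $a\in\mathbb{A}_V$ with $V$ non-empty, $$N^{\rm eff}(a,c):=\frac{\left(\sum_{i=1}^N\sum_{j=1}^N a^{ij}c^j\right)^2}{\sum_{i=1}^N\left(\sum_{j=1}^N a^{ij}c^j\right)^2}.$$ *)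

theory Defs
  imports "HOL-Analysis.Analysis"
begin

(* N x N matrices have type real^'n^'n with 'n :: finite, so that N = CARD('n) >= 1
   and [N] = (UNIV :: 'n set). The entry a^{ij} is a $ i $ j. *)

definition substochastic :: "real^'n^'n \<Rightarrow> bool" where
  "substochastic a \<longleftrightarrow> (\<forall>i j. 0 \<le> a $ i $ j) \<and> (\<forall>i. (\<Sum>j\<in>UNIV. a $ i $ j) \<le> 1)"

definition uniform_dist :: "'n set \<Rightarrow> real^'n" where
  "uniform_dist V = (\<chi> i. if i \<in> V then 1 / real (card V) else 0)"

(* The class A_V; v* multiplies a matrix by a row vector from the left. *)
definition inv_matrices :: "'n::finite set \<Rightarrow> (real^'n^'n) set" where
  "inv_matrices V = {a. substochastic a
      \<and> uniform_dist V v* a = uniform_dist V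
      \<and> (\<forall>i j. (i, j) \<notin> V \<times> V \<longrightarrow> a $ i $ j = 0)}"

(* phi(kappa(V)): the matrix of the complete graph with self-loops on V. *)
definition phi_complete :: "'n::finite set \<Rightarrow> real^'n^'n" where
  "phi_complete V = (\<chi> i j. if i \<in> V \<and> j \<in> V then 1 / real (card V) else 0)"

definition N_eff :: "real^'n^'n \<Rightarrow> real^'n \<Rightarrow> real" where
  "N_eff a c = (\<Sum>i\<in>UNIV. \<Sum>j\<in>UNIV. a $ i $ j * c $ j)\<^sup>2
             / (\<Sum>i\<in>UNIV. (\<Sum>j\<in>UNIV. a $ i $ j * c $ j)\<^sup>2)"

end

theory Submission
  imports Defs
begin

text \<open>
  Invariance of the uniform distribution means that the columns of \<open>a\<^sub>k\<close> indexed by \<open>V\<^sub>k\<close> sum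
  to one, so that \<open>a\<^sub>k c\<close> and \<open>\<phi>(\<kappa>(V\<^sub>k)) c\<close> both have total mass \<open>S\<^sub>k = \<Sum>\<^bsub>i\<in>V\<^sub>k\<^esub> c\<^sup>i\<close>. The supports
  being disjoint, numerators and sums of squares split over \<open>k\<close>. With \<open>Q\<^sub>k\<close> the sum of squares
  of \<open>a\<^sub>k c\<close>, the sum of squares of \<open>\<phi>(\<kappa>(V\<^sub>k)) c\<close> is \<open>S\<^sub>k\<^sup>2 / |V\<^sub>k|\<close>, which is at most \<open>Q\<^sub>k\<close> by
  Cauchy--Schwarz and equals \<open>N\<^sup>e\<^sup>f\<^sup>f(a\<^sub>k, c) / |V\<^sub>k|\<close> times \<open>Q\<^sub>k\<close>. Summing over \<open>k\<close> gives both bounds.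
\<close>

text \<open>All cross terms of the expanded square vanish. It is used at one fixed coordinate, where
  disjoint supports leave at most one non-zero summand.\<close>

lemma power2_sum_eq_sum_power2:
  fixes f :: "'a \<Rightarrow> 'b::comm_semiring_1"
  assumes "finite I" and "\<And>k l. k \<in> I \<Longrightarrow> l \<in> I \<Longrightarrow> k \<noteq> l \<Longrightarrow> f k * f l = 0"
  shows "(\<Sum>k\<in>I. f k)\<^sup>2 = (\<Sum>k\<in>I. (f k)\<^sup>2)"
proof -
  have "(\<Sum>k\<in>I. f k)\<^sup>2 = (\<Sum>k\<in>I. \<Sum>l\<in>I. f k * f l)"
    by (simp add: power2_eq_square sum_product)
  also have "\<dots> = (\<Sum>k\<in>I. \<Sum>l\<in>I. if k = l then (f k)\<^sup>2 else 0)"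
    using assms(2) by (intro sum.cong) (auto simp: power2_eq_square)
  finally show ?thesis
    using assms(1) by simp
qed

lemma N_eff_matrix_vector:
  "N_eff a c = (\<Sum>i\<in>UNIV. (a *v c) $ i)\<^sup>2 / (\<Sum>i\<in>UNIV. ((a *v c) $ i)\<^sup>2)"
  by (simp add: N_eff_def matrix_vector_mult_def)

lemma matrix_vector_mult_eq_0_outside:
  fixes a :: "real^'n^'n"
  assumes "\<And>i j. (i, j) \<notin> V \<times> V \<Longrightarrow> a $ i $ j = 0" and "i \<notin> V"
  shows "(a *v c) $ i = 0"
  using assms by (simp add: matrix_vector_mult_def)

text \<open>A coordinate lies in at most one \<open>V k\<close>, so the vectors
  \<open>a k *v c\<close> have disjoint supports and their squares add without cross terms. Only the
  support condition is assumed, so that one lemma serves both the given matrices and the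
  complete-graph ones.\<close>

lemma N_eff_sum:
  fixes a :: "'k \<Rightarrow> real^'n^'n"
  assumes "finite I" "disjoint_family_on V I"
    and supp: "\<And>k i j. k \<in> I \<Longrightarrow> (i, j) \<notin> V k \<times> V k \<Longrightarrow> a k $ i $ j = 0"
  shows "N_eff (\<Sum>k\<in>I. a k) c =
    (\<Sum>k\<in>I. \<Sum>i\<in>UNIV. (a k *v c) $ i)\<^sup>2 / (\<Sum>k\<in>I. \<Sum>i\<in>UNIV. ((a k *v c) $ i)\<^sup>2)"
proof -
  have mv: "((\<Sum>k\<in>I. a k) *v c) $ i = (\<Sum>k\<in>I. (a k *v c) $ i)" for i
    using assms(1) by induction (simp_all add: matrix_vector_mult_add_rdistrib)
  have "(a k *v c) $ i * (a l *v c) $ i = 0" if "k \<in> I" "l \<in> I" "k \<noteq> l" for k l i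
  proof -
    have "i \<notin> V k \<or> i \<notin> V l"
      using assms(2) that unfolding disjoint_family_on_def by blast
    then show ?thesis
      using matrix_vector_mult_eq_0_outside[of "V k" "a k"]
        matrix_vector_mult_eq_0_outside[of "V l" "a l"] supp that by auto
  qed
  then have "(((\<Sum>k\<in>I. a k) *v c) $ i)\<^sup>2 = (\<Sum>k\<in>I. ((a k *v c) $ i)\<^sup>2)" for i
    unfolding mv using assms(1) by (intro power2_sum_eq_sum_power2)
  then show ?thesis
    unfolding N_eff_matrix_vector by (simp add: mv sum.swap[of _ I])
qed

lemma inv_matrices_support:
  "a \<in> inv_matrices V \<Longrightarrow> (i, j) \<notin> V \<times> V \<Longrightarrow> a $ i $ j = 0"
  by (auto simp: inv_matrices_def)

lemma inv_matrices_column_sum: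
  assumes "a \<in> inv_matrices V" "j \<in> V"
  shows "(\<Sum>i\<in>UNIV. a $ i $ j) = 1"
proof -
  have "(\<Sum>i\<in>UNIV. a $ i $ j) = (\<Sum>i\<in>V. a $ i $ j)"
    using inv_matrices_support[OF assms(1)] by (intro sum.mono_neutral_right) auto
  \<comment> \<open>Coordinate \<open>j\<close> of the invariance equation is the column sum scaled
    by 1/|V|; \<open>j \<in> V\<close> makes |V| non-zero, so the factor cancels at the end.\<close>
  moreover have "(\<Sum>i\<in>V. a $ i $ j) / real (card V) = (uniform_dist V v* a) $ j"
    by (simp add: uniform_dist_def vector_matrix_mult_def sum.If_cases
        if_distrib[where f = "\<lambda>x. x * y" for y] sum_divide_distrib)
  moreover have "(uniform_dist V v* a) $ j = 1 / real (card V)"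
    using assms by (simp add: inv_matrices_def uniform_dist_def)
  ultimately show ?thesis
    using assms(2) by auto
qed

text \<open>Exchanging the sums weights each \<open>c $ j\<close> by its column sum, which is 1 on
  \<open>V\<close> and 0 elsewhere.\<close>

lemma inv_matrices_sum_matrix_vector:
  assumes "a \<in> inv_matrices V"
  shows "(\<Sum>i\<in>UNIV. (a *v c) $ i) = (\<Sum>j\<in>V. c $ j)"
proof -
  have "(\<Sum>i\<in>UNIV. (a *v c) $ i) = (\<Sum>j\<in>UNIV. (\<Sum>i\<in>UNIV. a $ i $ j) * c $ j)"
    unfolding matrix_vector_mult_def by (simp add: sum_distrib_right) (rule sum.swap)
  also have "\<dots> = (\<Sum>j\<in>V. (\<Sum>i\<in>UNIV. a $ i $ j) * c $ j)"
    using inv_matrices_support[OF assms] by (intro sum.mono_neutral_right) auto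
  also have "\<dots> = (\<Sum>j\<in>V. c $ j)"
    using inv_matrices_column_sum[OF assms] by simp
  finally show ?thesis .
qed

lemma phi_complete_matrix_vector:
  "(phi_complete V *v c) $ i = (if i \<in> V then (\<Sum>j\<in>V. c $ j) / real (card V) else 0)"
  by (simp add: phi_complete_def matrix_vector_mult_def sum.If_cases
      if_distrib[where f = "\<lambda>x. x * y" for y] sum_divide_distrib)

lemma sum_phi_complete_matrix_vector:
  assumes "V \<noteq> {}"
  shows "(\<Sum>i\<in>UNIV. (phi_complete V *v c) $ i) = (\<Sum>j\<in>V. c $ j)"
  using assms by (simp add: phi_complete_matrix_vector sum.If_cases)

text \<open>There are |V| equal non-zero squares (S/|V|)^2, with S the sum of \<open>c\<close> over
  \<open>V\<close>. For empty \<open>V\<close> both sides are 0, since division by 0 gives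
  0.\<close>

lemma sum_power2_phi_complete_matrix_vector:
  "(\<Sum>i\<in>UNIV. ((phi_complete V *v c) $ i)\<^sup>2) = (\<Sum>j\<in>V. c $ j)\<^sup>2 / real (card V)"
  by (simp add: phi_complete_matrix_vector if_distrib[where f = "\<lambda>x. x\<^sup>2"]
      sum.If_cases power_divide) (simp add: power2_eq_square)

text \<open>Cauchy-Schwarz against the all-ones vector, after restricting to the support
  \<open>V\<close>: this gives the factor |V| instead of N.\<close>

lemma power2_sum_le_card_mult:
  assumes "a \<in> inv_matrices V"
  shows "(\<Sum>j\<in>V. c $ j)\<^sup>2 \<le> real (card V) * (\<Sum>i\<in>UNIV. ((a *v c) $ i)\<^sup>2)"
proof -
  have zero: "(a *v c) $ i = 0" if "i \<notin> V" for i
    using matrix_vector_mult_eq_0_outside[of V a] inv_matrices_support[OF assms] that by blast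
  have "(\<Sum>j\<in>V. c $ j) = (\<Sum>i\<in>V. (a *v c) $ i)"
    by (rule trans[OF inv_matrices_sum_matrix_vector[OF assms, symmetric]],
        rule sum.mono_neutral_right) (use zero in auto)
  also have "\<dots>\<^sup>2 \<le> (\<Sum>i\<in>V. ((a *v c) $ i)\<^sup>2) * real (card V)"
    by (rule sum_squared_le_sum_of_squares)
  also have "(\<Sum>i\<in>V. ((a *v c) $ i)\<^sup>2) = (\<Sum>i\<in>UNIV. ((a *v c) $ i)\<^sup>2)"
    using zero by (intro sum.mono_neutral_left) auto
  finally show ?thesis
    by (simp add: mult.commute)
qed

theorem proposition4:
  fixes K :: nat
    and V :: "nat \<Rightarrow> 'n::finite set"
    and a :: "nat \<Rightarrow> real^'n^'n"
    and c :: "real^'n"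
  assumes "K \<ge> 1"
    and "\<And>k. k \<in> {1..K} \<Longrightarrow> V k \<noteq> {}"
    and "disjoint_family_on V {1..K}"
    and "\<And>k. k \<in> {1..K} \<Longrightarrow> a k \<in> inv_matrices (V k)"
    and "\<And>i. c $ i > 0"
  shows "N_eff (\<Sum>k\<in>{1..K}. phi_complete (V k)) c \<ge> N_eff (\<Sum>k\<in>{1..K}. a k) c
    \<and> N_eff (\<Sum>k\<in>{1..K}. a k) c
        \<ge> Min ((\<lambda>k. N_eff (a k) c / real (card (V k))) ` {1..K})
          * N_eff (\<Sum>k\<in>{1..K}. phi_complete (V k)) c"
proof -
  define S where "S k = (\<Sum>j\<in>V k. c $ j)" for k
  define n where "n k = real (card (V k))" for k
  define Q where "Q k = (\<Sum>i\<in>UNIV. ((a k *v c) $ i)\<^sup>2)" for k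
  define P where "P k = (S k)\<^sup>2 / n k" for k
  define m where "m = Min ((\<lambda>k. N_eff (a k) c / n k) ` {1..K})"
  define T where "T = (\<Sum>k\<in>{1..K}. S k)"
  have Na: "N_eff (\<Sum>k\<in>{1..K}. a k) c = T\<^sup>2 / sum Q {1..K}"
  proof (subst N_eff_sum[OF _ assms(3)])
    show "a k $ i $ j = 0" if "k \<in> {1..K}" "(i, j) \<notin> V k \<times> V k" for k i j
      using assms(4) inv_matrices_support that by blast
  qed (simp_all add: inv_matrices_sum_matrix_vector[OF assms(4)] T_def S_def Q_def
      del: One_nat_def)
  have Nphi: "N_eff (\<Sum>k\<in>{1..K}. phi_complete (V k)) c = T\<^sup>2 / sum P {1..K}"
  proof (subst N_eff_sum[OF _ assms(3)])
    show "phi_complete (V k) $ i $ j = 0" if "(i, j) \<notin> V k \<times> V k" for k i j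
      using that by (auto simp: phi_complete_def)
  qed (simp_all add: sum_phi_complete_matrix_vector assms(2)
      sum_power2_phi_complete_matrix_vector T_def S_def P_def n_def del: One_nat_def)
  \<comment> \<open>Positivity of \<open>c\<close> enters here; together with
    \<open>P k \<le> Q k\<close> it keeps all later denominators positive.\<close>
  have n: "n k > 0" and P: "P k > 0" if "k \<in> {1..K}" for k
  proof -
    show "n k > 0"
      using assms(2)[OF that] by (simp add: n_def card_gt_0_iff)
    moreover have "S k > 0"
      using assms(2)[OF that] assms(5) by (auto simp: S_def intro!: sum_pos)
    ultimately show "P k > 0"
      by (simp add: P_def)
  qed
  have PQ: "P k \<le> Q k" if "k \<in> {1..K}" for k
    using power2_sum_le_card_mult[OF assms(4)[OF that], of c] n[OF that]
    by (simp add: P_def S_def Q_def n_def field_simps)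
  have mQP: "m * Q k \<le> P k" if "k \<in> {1..K}" for k
  proof -
    have "Q k > 0"
      using P[OF that] PQ[OF that] by simp
    have "m \<le> N_eff (a k) c / n k"
      unfolding m_def using that by (intro Min_le) auto
    \<comment> \<open>\<open>N_eff (a k) c\<close> is (S k)^2 / Q k, and dividing by
      \<open>n k\<close> turns its numerator into \<open>P k\<close>.\<close>
    also have "\<dots> = P k / Q k"
      using assms(4)[OF that]
      by (simp add: N_eff_matrix_vector inv_matrices_sum_matrix_vector P_def Q_def S_def)
    finally show ?thesis
      using \<open>Q k > 0\<close> by (simp add: pos_le_divide_eq)
  qed
  have sumP: "sum P {1..K} > 0"
    using P assms(1) by (intro sum_pos) auto
  have sumPQ: "sum P {1..K} \<le> sum Q {1..K}"
    using PQ by (intro sum_mono)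
  then have sumQ: "sum Q {1..K} > 0"
    using sumP by linarith
  \<comment> \<open>Both effective sizes share the numerator T^2, so each bound reduces to comparing
    \<open>sum P\<close> with \<open>sum Q\<close>.\<close>
  have "m * sum Q {1..K} \<le> sum P {1..K}"
    unfolding sum_distrib_left using mQP by (intro sum_mono)
  then have "m / sum P {1..K} \<le> 1 / sum Q {1..K}"
    using sumP sumQ by (simp add: field_simps)
  then have "m * (T\<^sup>2 / sum P {1..K}) \<le> T\<^sup>2 / sum Q {1..K}"
    using mult_left_mono[of "m / sum P {1..K}" "1 / sum Q {1..K}" "T\<^sup>2"]
    by (simp add: mult.commute)
  moreover have "T\<^sup>2 / sum Q {1..K} \<le> T\<^sup>2 / sum P {1..K}"
    using sumPQ sumP by (intro divide_left_mono) auto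
  ultimately show ?thesis
    unfolding Na Nphi m_def n_def by blast
qed

end
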